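(* Let $n\ge 1$ and $m(x)=\prod_{j=1}^n x_j$. Over $[-1,1]^n$, $$\mu\big(\mathcal{G}(\operatorname{cav}_{[-1,1]^n}[m])\big)=\mu\big(\mathcal{G}(\operatorname{vex}_{[-1,1]^n}[m])\big)=\mu\big(\operatorname{conv}\mathcal{G}_{[-1,1]^n}(m)\big)=1+\Big(\frac{n-2}{n}\Big)^n.$$ This maximum error (of the convex hull) is attained at all the $2^n$ reflections of the point $\big(\frac{n-2}{n}\mathbf 1,-1\big)$.
   Context: $\mathbf 1\in\mathbb{R}^n$ is the all-ones vector. For a set $X\subseteq\mathbb{R}^n\times\mathbb{R}$, $\mu(X):=\max_{(x,w)\in X}|w-m(x)|$. For a set $S$, $\mathcal{G}_S(g)=\{(x,w)\in S\times\mathbb{R}\mid w=g(x)\}$ is the graph of $g$ over $S$. $\operatorname{vex}_S[m]$ and $\operatorname{cav}_S[m]$ are the convex and concave envelopes of $m$ over $S$ (the pointwise supremum of all convex underestimators, respectively the pointwise infimum of all concave overestimators, of $m$ on $S$), and $\mathcal{G}(\operatorname{vex}_S[m])$, $\mathcal{G}(\operatorname{cav}_S[m])$ are their graphs over $S$. A reflection of a point $(x,w)$ is, for a subset $I\subseteq\{1,\dots,n\}$, the point $(x',w')$ with $x'_j=-x_j$ for $j\in I$, $x'_j=x_j$ for $j\notin I$, and $w'=(-1)^{|I|}w$ (one reflection for each of the $2^n$ subsets $I$). *)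

theory Defs
  imports "HOL-Analysis.Analysis"
begin

text \<open>The dimension is \<open>n = CARD('n)\<close>; it is at least 1 since types are nonempty.\<close>

definition mon :: "real ^ 'n \<Rightarrow> real" where
  "mon x = (\<Prod>j\<in>UNIV. x $ j)"

definition graph_on :: "'a set \<Rightarrow> ('a \<Rightarrow> real) \<Rightarrow> ('a \<times> real) set" where
  "graph_on S g = {(x, w). x \<in> S \<and> w = g x}"

text \<open>The envelopes are real-valued and are meant to be evaluated on \<open>S\<close> only, for \<open>f\<close> bounded
  on \<open>S\<close>: there the families of functions are nonempty and their values at a point of \<open>S\<close>
  are bounded by \<open>f\<close>, so the supremum and infimum are the true ones.\<close>

definition vex :: "'a::real_vector set \<Rightarrow> ('a \<Rightarrow> real) \<Rightarrow> 'a \<Rightarrow> real" where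
  "vex S f x = (SUP g\<in>{g. convex_on S g \<and> (\<forall>y\<in>S. g y \<le> f y)}. g x)"

definition cav :: "'a::real_vector set \<Rightarrow> ('a \<Rightarrow> real) \<Rightarrow> 'a \<Rightarrow> real" where
  "cav S f x = (INF g\<in>{g. concave_on S g \<and> (\<forall>y\<in>S. f y \<le> g y)}. g x)"

definition errors :: "((real ^ 'n) \<times> real) set \<Rightarrow> real set" where
  "errors X = {\<bar>w - mon x\<bar> | x w. (x, w) \<in> X}"

definition has_max :: "real set \<Rightarrow> bool" where
  "has_max A \<longleftrightarrow> (\<exists>u\<in>A. \<forall>v\<in>A. v \<le> u)"

text \<open>\<open>\<mu>(X)\<close> is a maximum, not just a supremum: \<open>mu X\<close> is meaningful only if
  \<open>has_max (errors X)\<close>. (\<open>Max\<close> is of no use here, as it only covers finite sets.)\<close>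

definition mu :: "((real ^ 'n) \<times> real) set \<Rightarrow> real" where
  "mu X = (GREATEST e. e \<in> errors X)"

definition reflection :: "'n set \<Rightarrow> (real ^ 'n) \<times> real \<Rightarrow> (real ^ 'n) \<times> real" where
  "reflection I p =
     ((\<chi> j. if j \<in> I then - (fst p $ j) else fst p $ j), (-1) ^ card I * snd p)"

text \<open>In \<open>real ^ 'n\<close>, \<open>1\<close> is the all-ones vector, so this is \<open>[-1,1]\<^sup>n\<close>.\<close>

abbreviation Box :: "(real ^ 'n) set" where
  "Box \<equiv> cbox (- 1) 1"

end

theory Submission
  imports Defs
begin

text \<open>Two convex underestimators suffice: the constant \<open>-1\<close> and \<open>(\<Sum>j. x\<^sub>j) - (n - 1)\<close>.
  If \<open>n \<ge> 2\<close> and \<open>mon x \<le> 0\<close>, the constant alone suffices; if \<open>mon x > 0\<close>, an even number of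
  sign changes moves \<open>x\<close> into the nonnegative orthant, where the arithmetic-geometric mean inequality
  bounds the distance from \<open>mon x\<close> to the larger of the two by
  \<open>s^n + min 1 (n - 1 - n * s)\<close>, where \<open>s\<close> is the mean of the coordinates; this is
  largest at \<open>s = (n - 2) / n\<close>, where both minorants are equal. A single
  sign change exchanges minorants and majorants. The bound is attained because
  the mean of the \<open>n\<close> points obtained from the all-ones vector by flipping one sign is
  \<open>((n - 2) / n) *\<^sub>R 1\<close>, and \<open>mon\<close> is \<open>-1\<close> at each of them.\<close>

section \<open>Sign changes of coordinates and their effect on \<open>mon\<close>\<close>

definition flip :: "'n set \<Rightarrow> real ^ 'n \<Rightarrow> real ^ 'n" where
  "flip I x = (\<chi> j. if j \<in> I then - (x $ j) else x $ j)"

lemma flip_nth [simp]: "flip I x $ j = (if j \<in> I then - (x $ j) else x $ j)"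
  by (simp add: flip_def)

lemma flip_flip [simp]: "flip I (flip I x) = x"
  by (simp add: vec_eq_iff)

lemma linear_flip: "linear (flip I)"
  by (rule linearI) (auto simp: vec_eq_iff)

lemma mem_Box: "x \<in> Box \<longleftrightarrow> (\<forall>j. \<bar>x $ j\<bar> \<le> 1)"
  by (auto simp: mem_box_cart abs_le_iff minus_le_iff)

lemma flip_in_Box [simp]: "flip I x \<in> Box \<longleftrightarrow> x \<in> Box"
  unfolding mem_Box by (intro iff_allI) simp

lemma mon_flip: "mon (flip I x) = (-1) ^ card I * mon x"
proof -
  have "mon (flip I x) = (\<Prod>j\<in>UNIV. (if j \<in> I then -1 else 1) * x $ j)"
    unfolding mon_def by (rule prod.cong) auto
  also have "\<dots> = (\<Prod>j\<in>UNIV. if j \<in> I then -1 else 1) * mon x"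
    by (simp add: prod.distrib mon_def)
  finally show ?thesis
    by (simp add: prod.If_cases)
qed

lemma reflection_eq: "reflection I (x, w) = (flip I x, (-1) ^ card I * w)"
  by (simp add: reflection_def flip_def cong: if_cong)

lemma linear_reflection: "linear (reflection I)"
  by (rule linearI) (auto simp: reflection_def vec_eq_iff algebra_simps)

section \<open>Bounds on the monomial and on the error value\<close>

lemma abs_mon_le_1:
  assumes "x \<in> Box" shows "\<bar>mon x\<bar> \<le> 1"
  using assms by (auto simp: mon_def abs_prod mem_Box intro!: prod_le_1)

lemma mon_bounds:
  assumes "y \<in> Box" shows "-1 \<le> mon y" "mon y \<le> 1"
  using abs_mon_le_1[OF assms] by auto

text \<open>Factors enter one at a time: for a, b at most 1, (1 - a) * (1 - b) \<ge> 0 says a + b -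
  1 \<le> a * b. Absolute values are bounded so that partial products also stay at most 1.\<close>

lemma sum_le_prod:
  fixes y :: "'a \<Rightarrow> real"
  assumes "finite A" "\<And>j. j \<in> A \<Longrightarrow> \<bar>y j\<bar> \<le> 1"
  shows "(\<Sum>j\<in>A. y j) - (real (card A) - 1) \<le> (\<Prod>j\<in>A. y j)"
  using assms
proof (induction A rule: finite_induct)
  case (insert a A)
  have "\<bar>\<Prod>j\<in>A. y j\<bar> \<le> 1"
    using insert.prems by (auto simp: abs_prod intro!: prod_le_1)
  then have "0 \<le> (1 - y a) * (1 - (\<Prod>j\<in>A. y j))"
    using insert.prems[of a] by (intro mult_nonneg_nonneg) auto
  with insert show ?case
    by (force simp: algebra_simps)
qed simp

definition max_error :: "nat \<Rightarrow> real" where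
  "max_error n = 1 + ((real n - 2) / real n) ^ n"

lemma abs_ratio_le_1:
  assumes "n \<ge> 1" shows "\<bar>(real n - 2) / real n\<bar> \<le> 1"
  using assms by (auto simp: abs_le_iff field_simps)

lemma max_error_nonneg:
  assumes "n \<ge> 1" shows "0 \<le> max_error n"
proof -
  have "\<bar>((real n - 2) / real n) ^ n\<bar> \<le> 1"
    using abs_ratio_le_1[OF assms] by (simp add: power_abs power_le_one)
  then show ?thesis by (simp add: max_error_def)
qed

text \<open>From \<open>n = 2\<close> on the ratio is nonnegative. For \<open>n = 1\<close> it is -1
  and \<open>max_error\<close> is 0, which is why dimension one is treated apart in
  \<open>affine_minorant\<close>.\<close>

lemma max_error_ge_1:
  assumes "n \<ge> 2" shows "1 \<le> max_error n"
  using assms by (simp add: max_error_def)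

lemma mon_le_mean_power:
  fixes x :: "real ^ 'n"
  assumes "\<And>j. 0 \<le> x $ j"
  shows "mon x \<le> ((\<Sum>j\<in>UNIV. x $ j) / CARD('n)) ^ CARD('n)"
proof -
  have "0 \<le> mon x"
    using assms by (simp add: mon_def prod_nonneg)
  have "mon x powr (1 / CARD('n)) \<le> (\<Sum>j\<in>UNIV. x $ j) / CARD('n)"
    using arith_geom_mean[of "UNIV :: 'n set" "\<lambda>j. x $ j"] assms
    by (simp add: mon_def sum_divide_distrib)
  then have "(mon x powr (1 / CARD('n))) ^ CARD('n) \<le> ((\<Sum>j\<in>UNIV. x $ j) / CARD('n)) ^ CARD('n)"
    by (intro power_mono) auto
  \<comment> \<open>The conversion from \<open>powr\<close> by \<open>powr_realpow\<close> asks for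
    a positive base, so \<open>mon x = 0\<close> is split off; there \<open>powr\<close> has the
    value 0.\<close>
  moreover have "(mon x powr (1 / CARD('n))) ^ CARD('n) = mon x"
    using \<open>0 \<le> mon x\<close>
    by (cases "mon x = 0") (simp_all add: powr_powr flip: powr_realpow)
  ultimately show ?thesis by simp
qed

section \<open>Affine minorants and majorants close to the monomial\<close>

lemma affine_minorant_nonneg:
  fixes x :: "real ^ 'n"
  assumes "x \<in> Box" "\<And>j. 0 \<le> x $ j"
  shows "\<exists>f c. linear f \<and> (\<forall>y\<in>Box. f y + c \<le> mon y) \<and>
    mon x - (f x + c) \<le> max_error CARD('n)"
proof -
  define s where "s = (\<Sum>j\<in>UNIV. x $ j) / CARD('n)"
  define t where "t = (real CARD('n) - 2) / CARD('n)"
  have mon_le: "mon x \<le> s ^ CARD('n)"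
    unfolding s_def using assms(2) by (rule mon_le_mean_power)
  have "0 \<le> s"
    using assms(2) by (simp add: s_def sum_nonneg)
  have "(\<Sum>j\<in>UNIV. x $ j) \<le> (\<Sum>j\<in>(UNIV :: 'n set). 1)"
    using assms(1) by (intro sum_mono) (auto simp: mem_Box abs_le_iff)
  then have "s \<le> 1"
    by (simp add: s_def)
  show ?thesis
  proof (cases "s \<le> t")
    case True
    have "s ^ CARD('n) \<le> t ^ CARD('n)"
      using True \<open>0 \<le> s\<close> by (rule power_mono)
    with mon_le have "mon x + 1 \<le> max_error CARD('n)"
      by (simp add: max_error_def t_def)
    moreover have "\<forall>y\<in>Box. -1 \<le> mon (y :: real ^ 'n)"
      using mon_bounds(1) by blast
    ultimately show ?thesis
      by (intro exI[of _ "\<lambda>_. 0"] exI[of _ "-1"]) (auto simp: linear_zero)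
  next
    case False
    have "\<bar>t\<bar> \<le> 1"
      using abs_ratio_le_1[of "CARD('n)"] by (simp add: t_def Suc_le_eq)
    \<comment> \<open>On [-1,1] the n-th power is Lipschitz with constant n. Since n * t = n - 2,
      this turns the error bound s^n + n - 1 - n * s into at most 1 + t^n.\<close>
    then have "s ^ CARD('n) - t ^ CARD('n) \<le> CARD('n) * (s - t)"
      using norm_power_diff[of s t "CARD('n)"] False \<open>0 \<le> s\<close> \<open>s \<le> 1\<close> by simp
    moreover have "CARD('n) * s = (\<Sum>j\<in>UNIV. x $ j)" "CARD('n) * t = real CARD('n) - 2"
      by (simp_all add: s_def t_def)
    ultimately have "mon x - ((\<Sum>j\<in>UNIV. x $ j) + (1 - real CARD('n))) \<le> max_error CARD('n)"
      using mon_le by (simp add: max_error_def algebra_simps flip: t_def)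
    moreover have "linear (\<lambda>y :: real ^ 'n. \<Sum>j\<in>UNIV. y $ j)"
      by (rule linearI) (simp_all add: sum.distrib sum_distrib_left)
    moreover have "\<forall>y\<in>Box. (\<Sum>j\<in>UNIV. y $ j) + (1 - real CARD('n)) \<le> mon (y :: real ^ 'n)"
    proof
      fix y :: "real ^ 'n" assume "y \<in> Box"
      then show "(\<Sum>j\<in>UNIV. y $ j) + (1 - real CARD('n)) \<le> mon y"
        using sum_le_prod[of UNIV "\<lambda>j. y $ j"] by (simp add: mon_def mem_Box)
    qed
    ultimately show ?thesis
      by blast
  qed
qed

lemma affine_minorant:
  fixes x :: "real ^ 'n"
  assumes "x \<in> Box"
  shows "\<exists>f c. linear f \<and> (\<forall>y\<in>Box. f y + c \<le> mon y) \<and>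
    mon x - (f x + c) \<le> max_error CARD('n)"
proof (cases "CARD('n) = 1")
  case True
  then obtain k :: 'n where k: "UNIV = {k}"
    by (metis card_1_singletonE)
  \<comment> \<open>Here \<open>max_error\<close> is 0, so an exact minorant is required;
    \<open>mon\<close> is linear and serves as its own.\<close>
  have "linear (mon :: real ^ 'n \<Rightarrow> real)"
    unfolding mon_def by (rule linearI) (simp_all add: k)
  then show ?thesis
    using max_error_nonneg[of "CARD('n)"]
    by (intro exI[of _ mon] exI[of _ 0]) (auto simp: Suc_le_eq)
next
  case n: False
  show ?thesis
  proof (cases "mon x \<le> 0")
    case True
    have "CARD('n) \<ge> 2"
      using n zero_less_card_finite[where 'a = 'n] by linarith
    then have "mon x + 1 \<le> max_error CARD('n)"
      using True max_error_ge_1[of "CARD('n)"] by linarith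
    moreover have "\<forall>y\<in>Box. -1 \<le> mon (y :: real ^ 'n)"
      using mon_bounds(1) by blast
    ultimately show ?thesis
      by (intro exI[of _ "\<lambda>_. 0"] exI[of _ "-1"]) (auto simp: linear_zero)
  next
    case False
    define I where "I = {j. x $ j < 0}"
    have nonneg: "0 \<le> flip I x $ j" for j
      by (auto simp: I_def)
    then have "0 \<le> mon (flip I x)"
      unfolding mon_def by (intro prod_nonneg) blast
    \<comment> \<open>An odd number of flips would make \<open>mon (flip I x)\<close> negative,
      because \<open>mon x\<close> is positive in this case.\<close>
    then have sign: "(-1) ^ card I = (1 :: real)"
      using False by (auto simp: mon_flip minus_one_power_iff split: if_splits)
    obtain f c where f: "linear f" "\<And>y. y \<in> Box \<Longrightarrow> f y + c \<le> mon y"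
      "mon (flip I x) - (f (flip I x) + c) \<le> max_error CARD('n)"
      using affine_minorant_nonneg[of "flip I x"] nonneg assms flip_in_Box by blast
    have "linear (\<lambda>y. f (flip I y))"
      using linear_compose[OF linear_flip f(1)] by (simp add: o_def)
    \<comment> \<open>An even flip preserves both \<open>Box\<close> and \<open>mon\<close>, so
      composing with it carries minorants to minorants.\<close>
    moreover have "f (flip I y) + c \<le> mon y" if "y \<in> Box" for y
      using f(2)[of "flip I y"] that by (simp add: mon_flip sign)
    moreover have "mon x - (f (flip I x) + c) \<le> max_error CARD('n)"
      using f(3) by (simp add: mon_flip sign)
    ultimately show ?thesis
      by blast
  qed
qed

lemma affine_majorant:
  fixes x :: "real ^ 'n"
  assumes "x \<in> Box"
  shows "\<exists>f c. linear f \<and> (\<forall>y\<in>Box. mon y \<le> f y + c) \<and>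
    f x + c - mon x \<le> max_error CARD('n)"
proof -
  \<comment> \<open>Any coordinate will do. Flipping it negates \<open>mon\<close>, so a minorant
    composed with the flip and negated is a majorant with the same error.\<close>
  define k :: 'n where "k = undefined"
  have sign: "mon (flip {k} y) = - mon y" for y
    by (simp add: mon_flip)
  obtain f c where f: "linear f" "\<And>y. y \<in> Box \<Longrightarrow> f y + c \<le> mon y"
    "mon (flip {k} x) - (f (flip {k} x) + c) \<le> max_error CARD('n)"
    using affine_minorant[of "flip {k} x"] assms flip_in_Box by blast
  have "linear (\<lambda>y. - f (flip {k} y))"
    using linear_compose_neg[OF linear_compose[OF linear_flip f(1)]] by (simp add: o_def)
  moreover have "mon y \<le> - f (flip {k} y) + - c" if "y \<in> Box" for y
    using f(2)[of "flip {k} y"] that by (simp add: sign)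
  moreover have "- f (flip {k} x) + - c - mon x \<le> max_error CARD('n)"
    using f(3) by (simp add: sign)
  ultimately show ?thesis
    by blast
qed

section \<open>The convex hull of the graph and the two envelopes\<close>

lemma convex_on_affine:
  fixes f :: "'a::real_vector \<Rightarrow> real"
  assumes "linear f" "convex S"
  shows "convex_on S (\<lambda>y. f y + c)"
  unfolding convex_on_def
proof (intro conjI ballI allI impI)
  fix x y and u v :: real
  assume "u + v = 1"
  then have "u * c + v * c = c"
    by (metis distrib_right mult_1)
  then show "f (u *\<^sub>R x + v *\<^sub>R y) + c \<le> u * (f x + c) + v * (f y + c)"
    using assms(1) by (simp add: linear_add linear_cmul algebra_simps)
qed (fact assms(2))

lemma concave_on_affine:
  fixes f :: "'a::real_vector \<Rightarrow> real"
  assumes "linear f" "convex S"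
  shows "concave_on S (\<lambda>y. f y + c)"
  using convex_on_affine[OF linear_compose_neg[OF assms(1)] assms(2), of "- c"]
  by (simp add: concave_on_def)

text \<open>The epigraph of \<open>g\<close> is convex and contains the graph of \<open>f\<close>,
  hence also its convex hull.\<close>

lemma hull_graph_ge_convex:
  assumes "convex_on S g" "\<And>y. y \<in> S \<Longrightarrow> g y \<le> f y"
    and "(x, w) \<in> convex hull (graph_on S f)"
  shows "g x \<le> w"
proof -
  have "convex hull (graph_on S f) \<subseteq> epigraph S g"
    using assms(1,2) convex_on_imp_convex[OF assms(1)]
    by (intro hull_minimal) (auto simp: graph_on_def epigraph_def convex_epigraph[unfolded epigraph_def])
  with assms(3) show ?thesis by (auto simp: epigraph_def)
qed

text \<open>Negating the last coordinate is linear, so it commutes with the hull and reduces the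
  claim to the convex case for \<open>- g\<close> and \<open>- f\<close>.\<close>

lemma hull_graph_le_concave:
  assumes "concave_on S g" "\<And>y. y \<in> S \<Longrightarrow> f y \<le> g y"
    and "(x, w) \<in> convex hull (graph_on S f)"
  shows "w \<le> g x"
proof -
  have "linear (\<lambda>(x, w). (x, - w :: real))"
    by (rule linearI) auto
  moreover have "(\<lambda>(x, w). (x, - w)) ` graph_on S f = graph_on S (\<lambda>y. - f y)"
    by (force simp: graph_on_def)
  ultimately have "(\<lambda>(x, w). (x, - w)) ` (convex hull (graph_on S f)) = convex hull (graph_on S (\<lambda>y. - f y))"
    using convex_hull_linear_image by metis
  with assms(3) have "(x, - w) \<in> convex hull (graph_on S (\<lambda>y. - f y))"
    by force
  then have "- g x \<le> - w"
    using hull_graph_ge_convex[of S "\<lambda>y. - g y" "\<lambda>y. - f y" x "- w"] assms(1,2)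
    by (simp add: concave_on_def)
  then show ?thesis by simp
qed

text \<open>A real supremum dominates its members once they are bounded above; at a point of
  \<open>S\<close> the value \<open>f x\<close> is such a bound.\<close>

lemma vex_ge:
  assumes "x \<in> S" "convex_on S g" "\<And>y. y \<in> S \<Longrightarrow> g y \<le> f y"
  shows "g x \<le> vex S f x"
  unfolding vex_def using assms
  by (intro cSUP_upper bdd_aboveI2[where M = "f x"]) auto

lemma cav_le:
  assumes "x \<in> S" "concave_on S g" "\<And>y. y \<in> S \<Longrightarrow> f y \<le> g y"
  shows "cav S f x \<le> g x"
  unfolding cav_def using assms
  by (intro cINF_lower bdd_belowI2[where m = "f x"]) auto

lemma convex_on_const_Box: "convex_on Box (\<lambda>_ :: real ^ 'n. c :: real)"
  using convex_on_affine[OF linear_zero convex_box(1)] by simp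

lemma concave_on_const_Box: "concave_on Box (\<lambda>_ :: real ^ 'n. c :: real)"
  using concave_on_affine[OF linear_zero convex_box(1)] by simp

lemma vex_le_hull:
  fixes x :: "real ^ 'n"
  assumes "(x, w) \<in> convex hull (graph_on Box mon)"
  shows "vex Box mon x \<le> w"
  unfolding vex_def
proof (rule cSUP_least)
  \<comment> \<open>Bounding a real supremum from above requires a nonempty family; the constant -1
    is a member.\<close>
  show "{g. convex_on Box g \<and> (\<forall>y\<in>Box. g y \<le> mon (y :: real ^ 'n))} \<noteq> {}"
    using convex_on_const_Box[of "-1"] mon_bounds(1) by blast
qed (use hull_graph_ge_convex[OF _ _ assms] in blast)

lemma cav_ge_hull:
  fixes x :: "real ^ 'n"
  assumes "(x, w) \<in> convex hull (graph_on Box mon)"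
  shows "w \<le> cav Box mon x"
  unfolding cav_def
proof (rule cINF_greatest)
  show "{g. concave_on Box g \<and> (\<forall>y\<in>Box. mon (y :: real ^ 'n) \<le> g y)} \<noteq> {}"
    using concave_on_const_Box[of 1] mon_bounds(2) by blast
qed (use hull_graph_le_concave[OF _ _ assms] in blast)

lemma mem_hull_graph_mon:
  "x \<in> Box \<Longrightarrow> (x, mon x) \<in> convex hull (graph_on Box mon)"
  by (rule hull_inc) (simp add: graph_on_def)

lemma fst_hull_graph:
  assumes "(x, w) \<in> convex hull (graph_on S f)" "convex S"
  shows "x \<in> S"
proof -
  have "convex hull (graph_on S f) \<subseteq> S \<times> UNIV"
    using assms(2) by (intro hull_minimal convex_Times) (auto simp: graph_on_def)
  with assms(1) show ?thesis by blast
qed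

text \<open>Every point of the hull lies above the affine minorant and below the affine majorant
  chosen for its first component.\<close>

lemma hull_error_le:
  fixes x :: "real ^ 'n"
  assumes "(x, w) \<in> convex hull (graph_on Box mon)"
  shows "\<bar>w - mon x\<bar> \<le> max_error CARD('n)"
proof -
  have x: "x \<in> Box"
    using fst_hull_graph[OF assms] by simp
  have "mon x - w \<le> max_error CARD('n)"
    using affine_minorant[OF x] hull_graph_ge_convex[OF convex_on_affine _ assms]
    by (smt (verit) convex_box(1))
  moreover have "w - mon x \<le> max_error CARD('n)"
    using affine_majorant[OF x] hull_graph_le_concave[OF concave_on_affine _ assms]
    by (smt (verit) convex_box(1))
  ultimately show ?thesis by linarith
qed

text \<open>The envelope lies above the affine minorant chosen for \<open>x\<close> and below
  \<open>mon\<close>, the latter because \<open>(x, mon x)\<close> is itself a hull point.\<close>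

lemma vex_error_le:
  fixes x :: "real ^ 'n"
  assumes x: "x \<in> Box"
  shows "\<bar>vex Box mon x - mon x\<bar> \<le> max_error CARD('n)"
proof -
  obtain f c where "linear f" "\<And>y. y \<in> Box \<Longrightarrow> f y + c \<le> mon y"
    "mon x - (f x + c) \<le> max_error CARD('n)"
    using affine_minorant[OF x] by blast
  then show ?thesis
    using vex_ge[OF x convex_on_affine, of f c mon] vex_le_hull[OF mem_hull_graph_mon[OF x]] by simp
qed

lemma cav_error_le:
  fixes x :: "real ^ 'n"
  assumes x: "x \<in> Box"
  shows "\<bar>cav Box mon x - mon x\<bar> \<le> max_error CARD('n)"
proof -
  obtain f c where "linear f" "\<And>y. y \<in> Box \<Longrightarrow> mon y \<le> f y + c"
    "f x + c - mon x \<le> max_error CARD('n)"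
    using affine_majorant[OF x] by blast
  then show ?thesis
    using cav_le[OF x concave_on_affine, of f mon c] cav_ge_hull[OF mem_hull_graph_mon[OF x]] by simp
qed

section \<open>Attainment at the reflected peak and the three maxima\<close>

lemma reflection_in_hull:
  assumes "p \<in> convex hull (graph_on Box mon)"
  shows "reflection I p \<in> convex hull (graph_on Box mon)"
proof -
  have "reflection I ` (convex hull (graph_on Box mon)) = convex hull (reflection I ` graph_on Box mon)"
    by (rule convex_hull_linear_image[OF linear_reflection])
  \<comment> \<open>The sign that \<open>mon\<close> picks up under \<open>flip I\<close> is the one
    applied to the last component, so a reflection maps the graph into itself.\<close>
  also have "\<dots> \<subseteq> convex hull (graph_on Box mon)"
    by (intro hull_mono) (auto simp: graph_on_def reflection_eq mon_flip)
  finally show ?thesis using assms by blast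
qed

definition peak :: "real ^ 'n" where
  "peak = ((real CARD('n) - 2) / CARD('n)) *\<^sub>R 1"

lemma peak_in_hull: "(peak :: real ^ 'n, -1) \<in> convex hull (graph_on Box mon)"
proof -
  have "(\<Sum>i\<in>(UNIV :: 'n set). (1 / real CARD('n)) *\<^sub>R (flip {i} 1 :: real ^ 'n, -1 :: real))
    \<in> convex hull (graph_on Box mon)"
  proof (rule convex_sum)
    have "mon (1 :: real ^ 'n) = 1"
      by (simp add: mon_def)
    moreover have "(1 :: real ^ 'n) \<in> Box"
      by (simp add: mem_Box)
    ultimately show "(flip {i} 1, -1) \<in> convex hull (graph_on Box mon)" for i :: 'n
      using mem_hull_graph_mon[of "flip {i} 1"] by (simp add: mon_flip)
  qed auto
  moreover have "(\<Sum>i\<in>(UNIV :: 'n set). (1 / real CARD('n)) *\<^sub>R (flip {i} 1 :: real ^ 'n, -1 :: real))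
    = (peak, -1)"
  proof -
    have "(\<Sum>i\<in>UNIV. flip {i} 1 $ j) = real CARD('n) - 2" for j :: 'n
    proof -
      \<comment> \<open>Only the vertex with \<open>i = j\<close> has -1 in coordinate j, which
        lowers the sum from n to n - 2.\<close>
      have "(\<Sum>i\<in>UNIV. flip {i} 1 $ j) = (\<Sum>i\<in>UNIV. 1 - (if i = j then 2 else 0 :: real))"
        by (rule sum.cong) auto
      then show ?thesis by (simp add: sum_subtractf)
    qed
    then have "(\<Sum>i\<in>UNIV. (1 / real CARD('n)) *\<^sub>R flip {i} 1) = (peak :: real ^ 'n)"
      \<comment> \<open>\<open>flip_nth\<close> stays off so that the coordinate sums keep the form
        just evaluated.\<close>
      by (simp add: vec_eq_iff peak_def sum_divide_distrib[symmetric] del: flip_nth)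
    then show ?thesis
      by (simp add: prod_eq_iff fst_sum snd_sum)
  qed
  ultimately show ?thesis by simp
qed

lemma mon_peak: "mon (peak :: real ^ 'n) = max_error CARD('n) - 1"
  by (simp add: mon_def peak_def max_error_def)

text \<open>A reflection multiplies \<open>w - mon x\<close> by a sign, and at the peak this
  difference is \<open>- max_error CARD('n)\<close>.\<close>

lemma reflected_peak_error:
  assumes "(x, w) = reflection I (peak :: real ^ 'n, -1)"
  shows "\<bar>w - mon x\<bar> = max_error CARD('n)"
proof -
  have "w - mon x = (-1) ^ card I * (- max_error CARD('n))"
    using assms by (simp add: reflection_eq mon_flip mon_peak algebra_simps)
  then show ?thesis
    using max_error_nonneg[of "CARD('n)"] by (simp add: abs_mult Suc_le_eq)
qed

text \<open>An attained upper bound is the greatest element, which is what gives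
  \<open>GREATEST\<close> its meaning; used for all three sets.\<close>

lemma has_max_and_mu:
  assumes "\<And>x w. (x, w) \<in> X \<Longrightarrow> \<bar>w - mon x\<bar> \<le> M" "(a, b) \<in> X" "\<bar>b - mon a\<bar> = M"
  shows "has_max (errors X)" "mu X = M"
proof -
  have M: "M \<in> errors X" "\<And>e. e \<in> errors X \<Longrightarrow> e \<le> M"
    using assms by (auto simp: errors_def)
  show "has_max (errors X)"
    unfolding has_max_def using M by blast
  show "mu X = M"
    unfolding mu_def using M by (intro Greatest_equality)
qed

lemma hull_max:
  "has_max (errors (convex hull (graph_on (Box :: (real ^ 'n) set) mon)))"
  "mu (convex hull (graph_on (Box :: (real ^ 'n) set) mon)) = max_error CARD('n)"
proof -
  have "\<bar>-1 - mon (peak :: real ^ 'n)\<bar> = max_error CARD('n)"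
    using reflected_peak_error[of "peak :: real ^ 'n" "-1" "{}"] by (simp add: reflection_def)
  note * = has_max_and_mu[OF hull_error_le peak_in_hull this]
  show "has_max (errors (convex hull (graph_on (Box :: (real ^ 'n) set) mon)))"
    "mu (convex hull (graph_on (Box :: (real ^ 'n) set) mon)) = max_error CARD('n)"
    by (rule *; assumption)+
qed

lemma vex_max:
  "has_max (errors (graph_on (Box :: (real ^ 'n) set) (vex Box mon)))"
  "mu (graph_on (Box :: (real ^ 'n) set) (vex Box mon)) = max_error CARD('n)"
proof -
  have p: "(peak :: real ^ 'n) \<in> Box"
    using fst_hull_graph[OF peak_in_hull] by simp
  \<comment> \<open>The hull point \<open>(peak, -1)\<close> bounds the envelope from above, the
    constant minorant -1 from below.\<close>
  have "vex Box mon (peak :: real ^ 'n) = -1"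
    using vex_le_hull[OF peak_in_hull] vex_ge[OF p convex_on_const_Box mon_bounds(1)]
    by (intro antisym)
  then have "\<bar>vex Box mon (peak :: real ^ 'n) - mon (peak :: real ^ 'n)\<bar> = max_error CARD('n)"
    using reflected_peak_error[of "peak :: real ^ 'n" "-1" "{}"] by (simp add: reflection_def)
  moreover have "(peak :: real ^ 'n, vex Box mon (peak :: real ^ 'n)) \<in> graph_on Box (vex Box mon)"
    using p by (simp add: graph_on_def)
  moreover have "\<bar>w - mon x\<bar> \<le> max_error CARD('n)"
    if "(x, w) \<in> graph_on (Box :: (real ^ 'n) set) (vex Box mon)" for x w
    using that vex_error_le[of x] by (simp add: graph_on_def)
  ultimately show
    "has_max (errors (graph_on (Box :: (real ^ 'n) set) (vex Box mon)))"
    "mu (graph_on (Box :: (real ^ 'n) set) (vex Box mon)) = max_error CARD('n)"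
    by (blast intro: has_max_and_mu)+
qed

lemma cav_max:
  "has_max (errors (graph_on (Box :: (real ^ 'n) set) (cav Box mon)))"
  "mu (graph_on (Box :: (real ^ 'n) set) (cav Box mon)) = max_error CARD('n)"
proof -
  \<comment> \<open>One flip turns the height -1 of the peak into 1, where the concave envelope
    meets the constant majorant 1.\<close>
  define q :: "real ^ 'n" where "q = flip {undefined} peak"
  have q: "(q, 1) = reflection {undefined} (peak, -1)"
    by (simp add: reflection_eq q_def)
  then have hull: "(q, 1) \<in> convex hull (graph_on Box mon)"
    using reflection_in_hull[OF peak_in_hull] by simp
  then have box: "q \<in> Box"
    using fst_hull_graph[OF hull] by simp
  have "cav Box mon q = 1"
    using cav_ge_hull[OF hull] cav_le[OF box concave_on_const_Box mon_bounds(2)]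
    by (intro antisym)
  then have "\<bar>cav Box mon q - mon q\<bar> = max_error CARD('n)"
    using reflected_peak_error[OF q] by simp
  moreover have "(q, cav Box mon q) \<in> graph_on (Box :: (real ^ 'n) set) (cav Box mon)"
    using box by (simp add: graph_on_def)
  moreover have "\<bar>w - mon x\<bar> \<le> max_error CARD('n)"
    if "(x, w) \<in> graph_on (Box :: (real ^ 'n) set) (cav Box mon)" for x w
    using that cav_error_le[of x] by (simp add: graph_on_def)
  ultimately show
    "has_max (errors (graph_on (Box :: (real ^ 'n) set) (cav Box mon)))"
    "mu (graph_on (Box :: (real ^ 'n) set) (cav Box mon)) = max_error CARD('n)"
    by (blast intro: has_max_and_mu)+
qed

theorem theorem1p4:
  fixes n :: nat
    and Gcav Gvex H :: "((real ^ 'n) \<times> real) set"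
  defines "n \<equiv> CARD('n)"
    and "Gcav \<equiv> graph_on Box (cav Box mon)"
    and "Gvex \<equiv> graph_on Box (vex Box mon)"
    and "H \<equiv> convex hull (graph_on Box mon)"
  shows "has_max (errors Gcav) \<and> has_max (errors Gvex) \<and> has_max (errors H) \<and>
    mu Gcav = mu Gvex \<and> mu Gvex = mu H \<and>
    mu H = 1 + ((real n - 2) / real n) ^ n \<and>
    (\<forall>I x w. (x, w) = reflection I (((real n - 2) / real n) *\<^sub>R 1, -1) \<longrightarrow>
       (x, w) \<in> H \<and> \<bar>w - mon x\<bar> = mu H)"
proof -
  have mu: "mu H = max_error n" "mu Gvex = max_error n" "mu Gcav = max_error n"
    unfolding H_def Gvex_def Gcav_def n_def by (rule hull_max vex_max cav_max)+
  have max: "has_max (errors H)" "has_max (errors Gvex)" "has_max (errors Gcav)"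
    unfolding H_def Gvex_def Gcav_def by (rule hull_max vex_max cav_max)+
  have "(x, w) \<in> H \<and> \<bar>w - mon x\<bar> = mu H"
    if "(x, w) = reflection I (((real n - 2) / real n) *\<^sub>R 1, -1)" for I x w
  proof -
    have *: "(x, w) = reflection I (peak, -1)"
      using that by (simp add: peak_def n_def)
    then show ?thesis
      using reflection_in_hull[OF peak_in_hull] reflected_peak_error[OF *]
      by (simp add: H_def flip: mu(1)[unfolded H_def n_def])
  qed
  with mu max show ?thesis
    unfolding max_error_def by auto
qed

end
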